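(* Let $\mathcal{P}$ be a finite bounded poset with least element $\hat{0}$ and greatest element $\hat{1}$. The $m$-cover poset $\mathcal{P}^{\langle m\rangle}$ is a lattice for all integers $m>0$ if and only if the Hasse diagram of $\mathcal{P}$ with $\hat{0}$ removed is a tree rooted at $\hat{1}$.
   Context: For a finite bounded poset $\mathcal{P}=(P,\leq)$ with least element $\hat 0$ and an integer $m>0$, write $(\hat{0}^{l_0},p_1^{l_1},p_2^{l_2})$ for the $m$-tuple consisting of $l_0$ copies of $\hat0$, followed by $l_1$ copies of $p_1$, followed by $l_2$ copies of $p_2$ ($l_0+l_1+l_2=m$). The $m$-cover poset $\mathcal{P}^{\langle m\rangle}$ is the subposet of the $m$-fold direct product $\mathcal{P}^m$ (ordered componentwise) whose elements are the multichains $x_1\leq x_2\leq\cdots\leq x_m$ of $\mathcal{P}$ such that the set $\{x_1,\ldots,x_m\}\setminus\{\hat 0\}$ is empty, a single element, or a two-element set $\{p,q\}$ with $p\lessdot q$ ($q$ covers $p$ in $\mathcal{P}$); i.e. the tuples $(\hat{0}^{l_0},p^{l_1},q^{l_2})$ with $p\lessdot q$ (or with at most one non-$\hat0$ value). *)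

theory Defs
  imports "HOL-Algebra.Lattice"
begin

section \<open>The \<open>m\<close>-cover poset\<close>

definition covers :: "('a, 'b) gorder_scheme \<Rightarrow> 'a \<Rightarrow> 'a \<Rightarrow> bool" where
  "covers P p q \<longleftrightarrow> p \<in> carrier P \<and> q \<in> carrier P \<and> p \<sqsubset>\<^bsub>P\<^esub> q \<and>
     \<not> (\<exists>z \<in> carrier P. p \<sqsubset>\<^bsub>P\<^esub> z \<and> z \<sqsubset>\<^bsub>P\<^esub> q)"

text \<open>Elements of the direct power are the lists of length \<open>m\<close> over the carrier.\<close>

definition power_poset :: "('a, 'b) gorder_scheme \<Rightarrow> nat \<Rightarrow> 'a list gorder" where
  "power_poset P m =
     \<lparr> carrier = {xs. length xs = m \<and> set xs \<subseteq> carrier P},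
       eq = (=),
       le = list_all2 (le P) \<rparr>"

definition cover_poset :: "('a, 'b) gorder_scheme \<Rightarrow> nat \<Rightarrow> 'a list gorder" where
  "cover_poset P m =
     (power_poset P m)
       \<lparr> carrier := {xs \<in> carrier (power_poset P m).
           sorted_wrt (le P) xs \<and>
           (set xs - {\<bottom>\<^bsub>P\<^esub>} = {} \<or>
            (\<exists>p. set xs - {\<bottom>\<^bsub>P\<^esub>} = {p}) \<or>
            (\<exists>p q. covers P p q \<and> set xs - {\<bottom>\<^bsub>P\<^esub>} = {p, q}))} \<rparr>"

section \<open>Rooted trees and Hasse diagrams\<close>

text \<open>A simple undirected graph is given by a vertex set \<open>V\<close> and a set \<open>E\<close> of
  two-element subsets of \<open>V\<close>. The notion of tree in the AFP entry Graph-Theory is not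
  usable here: its cycles are directed ones, so there every connected acyclic digraph
  is a tree, while a symmetric digraph with an edge is never one.\<close>

definition connected_graph :: "'a set \<Rightarrow> 'a set set \<Rightarrow> bool" where
  "connected_graph V E \<longleftrightarrow> (\<forall>u \<in> V. \<forall>v \<in> V. (u, v) \<in> {(x, y). {x, y} \<in> E}\<^sup>*)"

definition cycle_in :: "'a set set \<Rightarrow> 'a list \<Rightarrow> bool" where
  "cycle_in E xs \<longleftrightarrow> length xs \<ge> 3 \<and> distinct xs \<and>
     (\<forall>i < length xs. {xs ! i, xs ! (Suc i mod length xs)} \<in> E)"

definition tree_graph :: "'a set \<Rightarrow> 'a set set \<Rightarrow> bool" where
  "tree_graph V E \<longleftrightarrow> connected_graph V E \<and> \<not> (\<exists>xs. cycle_in E xs)"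

text \<open>The empty graph counts as a (degenerate) rooted tree. It occurs only as the diagram of
  the one-element poset with its only element removed; every nonempty rooted tree
  contains its root.\<close>

definition tree_rooted_at :: "'a set \<Rightarrow> 'a set set \<Rightarrow> 'a \<Rightarrow> bool" where
  "tree_rooted_at V E r \<longleftrightarrow> tree_graph V E \<and> (V \<noteq> {} \<longrightarrow> r \<in> V)"

definition hasse_edges :: "('a, 'b) gorder_scheme \<Rightarrow> 'a set set" where
  "hasse_edges P = {{p, q} | p q. covers P p q}"

end

theory Submission
  imports Defs "HOL-Algebra.Complete_Lattice"
begin

text \<open>Both sides are equivalent to: every element other than \<open>\<bottom>\<close> has at most one upper cover.
  If so, the elements above a nonzero element form a chain, so two incomparable elements have
  meet \<open>\<bottom>\<close>, and the \<open>m\<close>-cover poset is closed under componentwise meets; being finite with a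
  greatest element, it is a lattice. Conversely, two upper covers \<open>a\<close> and \<open>b\<close> of a nonzero \<open>x\<close>
  leave \<open>(x, a)\<close> and \<open>(x, b)\<close> without a join already for \<open>m = 2\<close>.\<close>

section \<open>Cycles in simple graphs\<close>

text \<open>Trading the index arithmetic modulo the length for \<open>successively\<close> allows a
  cycle to be assembled by concatenating and reversing chains.\<close>

lemma cycle_in_iff_successively:
  "cycle_in E xs \<longleftrightarrow> length xs \<ge> 3 \<and> distinct xs \<and>
     successively (\<lambda>x y. {x, y} \<in> E) xs \<and> {last xs, hd xs} \<in> E"
proof -
  have "(\<forall>i < length xs. {xs ! i, xs ! (Suc i mod length xs)} \<in> E) \<longleftrightarrow>
      successively (\<lambda>x y. {x, y} \<in> E) xs \<and> {last xs, hd xs} \<in> E" if len: "length xs \<ge> 3"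
  proof -
    have ne: "xs \<noteq> []"
      using len by (cases xs) auto
    have last: "last xs = xs ! (length xs - 1)" and hd: "hd xs = xs ! 0"
      using ne by (simp_all add: last_conv_nth hd_conv_nth)
    show ?thesis
    proof (intro iffI conjI allI impI)
      assume *: "\<forall>i < length xs. {xs ! i, xs ! (Suc i mod length xs)} \<in> E"
      show "successively (\<lambda>x y. {x, y} \<in> E) xs"
        unfolding successively_conv_nth
      proof (intro allI impI)
        fix i assume "Suc i < length xs"
        then show "{xs ! i, xs ! Suc i} \<in> E"
          using *[rule_format, of i] by simp
      qed
      show "{last xs, hd xs} \<in> E"
        using *[rule_format, of "length xs - 1"] ne unfolding last hd by simp
    next
      fix i
      assume *: "successively (\<lambda>x y. {x, y} \<in> E) xs \<and> {last xs, hd xs} \<in> E"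
        and i: "i < length xs"
      show "{xs ! i, xs ! (Suc i mod length xs)} \<in> E"
      proof (cases "Suc i < length xs")
        case True
        then show ?thesis
          using * by (simp add: successively_conv_nth)
      next
        case False
        then have "Suc i = length xs"
          using i by simp
        then have "i = length xs - 1" "Suc i mod length xs = 0"
          by simp_all
        then show ?thesis
          using * unfolding last hd by simp
      qed
    qed
  qed
  then show ?thesis
    unfolding cycle_in_def by blast
qed

text \<open>The two neighbours are the cyclic successor and predecessor of \<open>x\<close>;
  distinctness of the list turns different positions into different vertices.\<close>

lemma cycle_in_neighbours:
  assumes cyc: "cycle_in E xs" and x: "x \<in> set xs"
  obtains a b where "a \<in> set xs" "b \<in> set xs" "a \<noteq> b" "{x, a} \<in> E" "{x, b} \<in> E"
proof -
  from x obtain i where i: "i < length xs" "xs ! i = x"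
    by (auto simp: in_set_conv_nth)
  have len: "length xs \<ge> 3" and dist: "distinct xs"
    and edge: "\<And>i. i < length xs \<Longrightarrow> {xs ! i, xs ! (Suc i mod length xs)} \<in> E"
    using cyc by (auto simp: cycle_in_def)
  define s where "s = Suc i mod length xs"
  define p where "p = (if i = 0 then length xs - 1 else i - 1)"
  have p: "p < length xs" "Suc p mod length xs = i"
    using i(1) by (auto simp: p_def)
  have s: "s < length xs"
    using i(1) unfolding s_def by (intro mod_less_divisor) linarith
  \<comment> \<open>This is where the length bound 3 enters: on a closed walk through two vertices,
    successor and predecessor coincide.\<close>
  have "s \<noteq> p"
  proof (cases "Suc i < length xs")
    case True
    then show ?thesis
      using len by (auto simp: s_def p_def)
  next
    case False
    then have "Suc i = length xs"
      using i by simp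
    then show ?thesis
      using len by (auto simp: s_def p_def)
  qed
  then have "xs ! s \<noteq> xs ! p"
    using s p(1) dist by (simp add: nth_eq_iff_index_eq)
  moreover have "{x, xs ! s} \<in> E"
    using edge[OF i(1)] i(2) by (simp add: s_def)
  moreover have "{x, xs ! p} \<in> E"
    using edge[OF p(1)] i(2) p(2) by (simp add: insert_commute)
  ultimately show ?thesis
    using that s p(1) nth_mem by blast
qed

section \<open>Covers and saturated chains in a finite bounded poset\<close>

locale finite_bounded_poset =
  partial_order P + weak_partial_order_bottom P + weak_partial_order_top P
  for P (structure) +
  assumes finite_carrier: "finite (carrier P)"
begin

text \<open>As a relation, so that uniqueness of upper covers reads \<open>single_valued\<close> and
  \<open>single_valued_confluent\<close> applies to the closure.\<close>

abbreviation nonzero_covers :: "('a \<times> 'a) set" where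
  "nonzero_covers \<equiv> {(x, y). covers P x y \<and> x \<noteq> \<bottom>}"

abbreviation nonzero_edges :: "'a set set" where
  "nonzero_edges \<equiv> {e \<in> hasse_edges P. \<bottom> \<notin> e}"

lemma covers_iff:
  "covers P p q \<longleftrightarrow> p \<in> carrier P \<and> q \<in> carrier P \<and> p \<sqsubseteq> q \<and> p \<noteq> q \<and>
     (\<forall>z \<in> carrier P. p \<sqsubseteq> z \<longrightarrow> z \<sqsubseteq> q \<longrightarrow> z = p \<or> z = q)"
  unfolding covers_def lless_eq by blast

lemma coversD:
  assumes "covers P p q"
  shows "p \<in> carrier P" "q \<in> carrier P" "p \<sqsubseteq> q" "p \<noteq> q"
  using assms by (auto simp: covers_iff)

lemma le_bottom_iff: "x \<in> carrier P \<Longrightarrow> x \<sqsubseteq> \<bottom> \<longleftrightarrow> x = \<bottom>"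
  using le_antisym by auto

lemma nonzero_above: "x \<in> carrier P \<Longrightarrow> y \<in> carrier P \<Longrightarrow> x \<sqsubseteq> y \<Longrightarrow> x \<noteq> \<bottom> \<Longrightarrow> y \<noteq> \<bottom>"
  using le_bottom_iff by auto

lemma pair_in_hasse_edges_iff: "{x, y} \<in> hasse_edges P \<longleftrightarrow> covers P x y \<or> covers P y x"
  by (auto simp: hasse_edges_def doubleton_eq_iff)

lemma pair_in_nonzero_edges_iff:
  "{x, y} \<in> nonzero_edges \<longleftrightarrow> x \<noteq> \<bottom> \<and> y \<noteq> \<bottom> \<and> (covers P x y \<or> covers P y x)"
  by (auto simp: pair_in_hasse_edges_iff)

lemma minimal_elementE:
  assumes "A \<subseteq> carrier P" "A \<noteq> {}"
  obtains z where "z \<in> A" "\<And>x. x \<in> A \<Longrightarrow> x \<sqsubseteq> z \<Longrightarrow> x = z"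
proof -
  have "finite A"
    using assms(1) finite_carrier finite_subset by blast
  moreover have "asymp_on A (\<sqsubset>)"
    using assms(1) by (intro asymp_onI) (meson lless_antisym subsetD)
  moreover have "transp_on A (\<sqsubset>)"
    using assms(1) by (intro transp_onI) (meson lless_trans subsetD)
  ultimately obtain z where "z \<in> A" "\<forall>x \<in> A. x \<noteq> z \<longrightarrow> \<not> x \<sqsubset> z"
    using Finite_Set.bex_min_element[of A "(\<sqsubset>)"] assms(2) by blast
  then have "\<And>x. x \<in> A \<Longrightarrow> x \<sqsubseteq> z \<Longrightarrow> x = z"
    unfolding lless_eq by blast
  then show ?thesis
    using that \<open>z \<in> A\<close> by blast
qed

text \<open>A minimal element among those strictly above \<open>x\<close> and below \<open>y\<close>
  covers \<open>x\<close>.\<close>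

lemma upper_cover_below:
  assumes "x \<in> carrier P" "y \<in> carrier P" "x \<sqsubseteq> y" "x \<noteq> y"
  obtains c where "covers P x c" "c \<sqsubseteq> y"
proof -
  let ?A = "{z \<in> carrier P. x \<sqsubseteq> z \<and> x \<noteq> z \<and> z \<sqsubseteq> y}"
  obtain c where c: "c \<in> ?A" "\<And>z. z \<in> ?A \<Longrightarrow> z \<sqsubseteq> c \<Longrightarrow> z = c"
    by (rule minimal_elementE[of ?A]) (use assms in auto)
  have "z = x \<or> z = c" if "z \<in> carrier P" "x \<sqsubseteq> z" "z \<sqsubseteq> c" for z
    using c(1) c(2)[of z] that assms(2) le_trans[of z c y] by blast
  then have "covers P x c"
    using c(1) assms(1) by (auto simp: covers_iff)
  then show ?thesis
    using that c(1) by blast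
qed

text \<open>Climb from \<open>x\<close> to an upper cover that is still below \<open>y\<close>; the
  number of elements above the current point drops, since the point itself is lost.\<close>

lemma le_imp_covers_rtrancl:
  assumes "x \<in> carrier P" "y \<in> carrier P" "x \<sqsubseteq> y"
  shows "(x, y) \<in> {(x, y). covers P x y}\<^sup>*"
  using assms
proof (induction "card {z \<in> carrier P. x \<sqsubseteq> z}" arbitrary: x rule: less_induct)
  case less
  show ?case
  proof (cases "x = y")
    case False
    then obtain c where c: "covers P x c" "c \<sqsubseteq> y"
      using upper_cover_below less.prems by blast
    have "{z \<in> carrier P. c \<sqsubseteq> z} \<subset> {z \<in> carrier P. x \<sqsubseteq> z}"
      using coversD[OF c(1)] le_trans[of x c] le_antisym[of x c] by blast
    then have "card {z \<in> carrier P. c \<sqsubseteq> z} < card {z \<in> carrier P. x \<sqsubseteq> z}"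
      using finite_carrier by (intro psubset_card_mono) auto
    then have "(c, y) \<in> {(x, y). covers P x y}\<^sup>*"
      using less.hyps less.prems(2) c coversD(2) by blast
    then show ?thesis
      using c(1) by (intro converse_rtrancl_into_rtrancl[of x c]) auto
  qed simp
qed

lemma covers_rtrancl_imp_le:
  assumes "(x, y) \<in> {(x, y). covers P x y}\<^sup>*" "x \<in> carrier P"
  shows "y \<in> carrier P \<and> x \<sqsubseteq> y"
  using assms(1)
proof (induction rule: rtrancl_induct)
  case base
  show ?case using assms(2) by simp
next
  case (step y z)
  then show ?case
    using coversD[of y z] le_trans[of x y z] assms(2) by auto
qed

text \<open>The last step of a path of covers from \<open>x\<close> to \<open>y\<close> provides the
  lower cover of \<open>y\<close>.\<close>

lemma lower_cover_above:
  assumes "x \<in> carrier P" "y \<in> carrier P" "x \<sqsubseteq> y" "x \<noteq> y"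
  obtains c where "x \<sqsubseteq> c" "covers P c y"
  using le_imp_covers_rtrancl[OF assms(1-3)]
proof (cases rule: rtranclE)
  case base
  then show ?thesis using assms(4) by simp
next
  case (step c)
  then show ?thesis
    using that covers_rtrancl_imp_le assms(1) by blast
qed

text \<open>The path of covers as a list, ready to become part of a cycle. It is distinct because
  each new head lies strictly below all later entries.\<close>

lemma saturated_chain:
  assumes "x \<in> carrier P" "y \<in> carrier P" "x \<sqsubseteq> y"
  obtains zs where "zs \<noteq> []" "hd zs = x" "last zs = y" "distinct zs" "successively (covers P) zs"
    "\<And>z. z \<in> set zs \<Longrightarrow> z \<in> carrier P \<and> x \<sqsubseteq> z \<and> z \<sqsubseteq> y"
proof -
  have "x \<in> carrier P \<longrightarrow> (\<exists>zs. zs \<noteq> [] \<and> hd zs = x \<and> last zs = y \<and> distinct zs \<and>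
      successively (covers P) zs \<and> (\<forall>z \<in> set zs. z \<in> carrier P \<and> x \<sqsubseteq> z \<and> z \<sqsubseteq> y))"
    using le_imp_covers_rtrancl[OF assms]
  proof (induction rule: converse_rtrancl_induct)
    case base
    show ?case
      by (auto intro!: exI[of _ "[y]"])
  next
    case (step x c)
    then have c: "covers P x c"
      by simp
    note cD = coversD[OF c]
    from step cD obtain zs where zs: "zs \<noteq> []" "hd zs = c" "last zs = y" "distinct zs"
        "successively (covers P) zs" "\<forall>z \<in> set zs. z \<in> carrier P \<and> c \<sqsubseteq> z \<and> z \<sqsubseteq> y"
      by blast
    have "x \<notin> set zs"
      using zs(6) cD le_antisym by blast
    moreover have "c \<sqsubseteq> y"
      using zs by auto
    ultimately show ?case
      using zs c cD assms(2) le_trans[of x c]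
      by (intro impI exI[of _ "x # zs"]) (auto simp: successively_Cons)
  qed
  then show ?thesis
    using that assms(1) by blast
qed

section \<open>Trees and unique upper covers\<close>

text \<open>Every nonzero element climbs to \<open>\<top>\<close> along covers without ever meeting
  \<open>\<bottom>\<close>, and edges can be traversed in both directions.\<close>

lemma nonzero_graph_connected: "connected_graph (carrier P - {\<bottom>}) nonzero_edges"
proof -
  let ?R = "{(x, y). {x, y} \<in> nonzero_edges}"
  have sym: "sym ?R"
    by (auto simp: sym_def insert_commute)
  have to_top: "(x, \<top>) \<in> ?R\<^sup>*" if "x \<in> carrier P - {\<bottom>}" for x
  proof -
    have "(x, \<top>) \<in> {(x, y). covers P x y}\<^sup>*"
      using that by (intro le_imp_covers_rtrancl) auto
    \<comment> \<open>The start of the path varies in the induction, so its being nonzero is carried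
      inside the formula.\<close>
    then have "x \<in> carrier P - {\<bottom>} \<longrightarrow> (x, \<top>) \<in> ?R\<^sup>*"
    proof (induction rule: converse_rtrancl_induct)
      case (step x c)
      then show ?case
        using coversD[of x c] nonzero_above[of x c]
        by (auto simp: pair_in_hasse_edges_iff intro: converse_rtrancl_into_rtrancl)
    qed simp
    then show ?thesis
      using that by blast
  qed
  show ?thesis
    unfolding connected_graph_def
  proof (intro ballI)
    fix u v assume "u \<in> carrier P - {\<bottom>}" "v \<in> carrier P - {\<bottom>}"
    then have "(u, \<top>) \<in> ?R\<^sup>*" "(\<top>, v) \<in> ?R\<^sup>*"
      using to_top symD[OF sym_rtrancl[OF sym]] by blast+
    then show "(u, v) \<in> ?R\<^sup>*"
      by (rule rtrancl_trans)
  qed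
qed

text \<open>A minimal common upper bound \<open>j\<close> of two covers of \<open>x\<close> closes a cycle: the saturated chains
  up to \<open>j\<close> meet only in \<open>j\<close>.\<close>

lemma acyclic_imp_single_valued:
  assumes acyc: "\<not> (\<exists>xs. cycle_in nonzero_edges xs)"
  shows "single_valued nonzero_covers"
proof (rule single_valuedI)
  fix x a b assume "(x, a) \<in> nonzero_covers" "(x, b) \<in> nonzero_covers"
  then have xa: "covers P x a" and xb: "covers P x b" and x0: "x \<noteq> \<bottom>"
    by auto
  note aD = coversD[OF xa] and bD = coversD[OF xb]
  show "a = b"
  proof (rule ccontr)
    assume ab: "a \<noteq> b"
    let ?U = "{z \<in> carrier P. a \<sqsubseteq> z \<and> b \<sqsubseteq> z}"
    obtain j where j: "j \<in> ?U" "\<And>z. z \<in> ?U \<Longrightarrow> z \<sqsubseteq> j \<Longrightarrow> z = j"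
      by (rule minimal_elementE[of ?U]) (use aD bD in auto)
    obtain as where as: "as \<noteq> []" "hd as = a" "last as = j" "distinct as"
        "successively (covers P) as" "\<And>z. z \<in> set as \<Longrightarrow> z \<in> carrier P \<and> a \<sqsubseteq> z \<and> z \<sqsubseteq> j"
      by (rule saturated_chain[of a j]) (use j aD in auto)
    obtain bs where bs: "bs \<noteq> []" "hd bs = b" "last bs = j" "distinct bs"
        "successively (covers P) bs" "\<And>z. z \<in> set bs \<Longrightarrow> z \<in> carrier P \<and> b \<sqsubseteq> z \<and> z \<sqsubseteq> j"
      by (rule saturated_chain[of b j]) (use j bD in auto)
    \<comment> \<open>Distinct upper covers of \<open>x\<close> are incomparable, so neither of them
      is an upper bound of both.\<close>
    have b_le_imp: "a \<noteq> j" "b \<noteq> j"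
      using j(1) xa xb ab aD bD unfolding covers_iff by auto
    \<comment> \<open>\<open>j\<close> already ends \<open>as\<close>; it is dropped here so that
      the cycle visits it only once.\<close>
    obtain bs' where bs': "bs = bs' @ [j]" "bs' \<noteq> []"
      using bs b_le_imp(2) by (metis append_butlast_last_id append_Nil list.sel(1))
    have hd_bs': "hd bs' = b"
      using bs(2) bs' by simp
    \<comment> \<open>From \<open>x\<close> up to \<open>j\<close> through \<open>a\<close>, then
      down to \<open>b\<close>; the closing edge leads from \<open>b\<close> back to
      \<open>x\<close>.\<close>
    let ?c = "x # as @ rev bs'"
    have x_notin: "x \<notin> set as" "x \<notin> set bs'"
      using as(6) bs(6) bs'(1) aD bD le_antisym[of x a] le_antisym[of x b] by auto
    have disj: "set as \<inter> set bs' = {}"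
    proof -
      have "z = j" if "z \<in> set as" "z \<in> set bs'" for z
      proof -
        have "z \<in> carrier P \<and> a \<sqsubseteq> z \<and> z \<sqsubseteq> j" "b \<sqsubseteq> z"
          using as(6) bs(6) that bs'(1) by simp_all
        then show ?thesis
          using j(2) by simp
      qed
      moreover have "j \<notin> set bs'"
        using bs(4) bs'(1) by simp
      ultimately show ?thesis by blast
    qed
    have "a \<noteq> \<bottom>" "b \<noteq> \<bottom>"
      using nonzero_above aD bD x0 by metis+
    then have nz: "z \<noteq> \<bottom>" if "z \<in> set as \<or> z \<in> set bs" for z
      using that as(6)[of z] bs(6)[of z] nonzero_above[of a z] nonzero_above[of b z] aD(2) bD(2)
      by metis
    have edges_as: "successively (\<lambda>u v. {u, v} \<in> nonzero_edges) as"
      by (rule successively_mono[OF as(5)]) (use nz in \<open>auto simp: pair_in_hasse_edges_iff\<close>)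
    have "successively (\<lambda>u v. {u, v} \<in> nonzero_edges) bs"
      by (rule successively_mono[OF bs(5)]) (use nz in \<open>auto simp: pair_in_hasse_edges_iff\<close>)
    then have edges_bs: "successively (\<lambda>u v. {u, v} \<in> nonzero_edges) (rev bs)"
      unfolding successively_rev by (rule successively_mono) (simp add: insert_commute)
    have "successively (\<lambda>u v. {u, v} \<in> nonzero_edges) ?c"
      using edges_as edges_bs as(1-3) bs'(2) xa x0 nz[of a] hd_in_set[OF as(1)]
      unfolding bs'(1)
      by (auto simp: successively_Cons successively_append_iff pair_in_hasse_edges_iff)
    moreover have "{last ?c, hd ?c} \<in> nonzero_edges"
      using bs'(2) hd_bs' xb x0 nz[of b] hd_in_set[OF bs(1)] bs(2)
      by (simp add: last_rev pair_in_hasse_edges_iff)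
    moreover have "distinct ?c"
      using as(4) bs(4) bs'(1) x_notin disj by auto
    moreover have "length ?c \<ge> 3"
      using as(1) bs'(2) by (cases as; cases bs') auto
    ultimately have "cycle_in nonzero_edges ?c"
      unfolding cycle_in_iff_successively by blast
    then show False
      using acyc by blast
  qed
qed

text \<open>Both neighbours of a minimal vertex of a cycle cover it.\<close>

lemma single_valued_imp_acyclic:
  assumes sv: "single_valued nonzero_covers"
  shows "\<not> cycle_in nonzero_edges xs"
proof
  assume cyc: "cycle_in nonzero_edges xs"
  have mem: "x \<in> carrier P" if "x \<in> set xs" for x
  proof -
    obtain a where "{x, a} \<in> nonzero_edges"
      using cyc \<open>x \<in> set xs\<close> by (rule cycle_in_neighbours)
    then show ?thesis
      unfolding pair_in_nonzero_edges_iff using coversD by blast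
  qed
  have "set xs \<noteq> {}"
    using cyc by (auto simp: cycle_in_def)
  then obtain x where x: "x \<in> set xs" "\<And>y. y \<in> set xs \<Longrightarrow> y \<sqsubseteq> x \<Longrightarrow> y = x"
    using minimal_elementE[of "set xs"] mem by blast
  obtain a b where ab: "a \<in> set xs" "b \<in> set xs" "a \<noteq> b"
      "{x, a} \<in> nonzero_edges" "{x, b} \<in> nonzero_edges"
    using cyc x(1) by (rule cycle_in_neighbours)
  have up: "(x, y) \<in> nonzero_covers" if "y \<in> set xs" "{x, y} \<in> nonzero_edges" for y
    using x(2)[of y] that coversD[of y x] unfolding pair_in_nonzero_edges_iff by auto
  show False
    using single_valuedD[OF sv up[OF ab(1,4)] up[OF ab(2,5)]] ab(3) by simp
qed

text \<open>Connectedness and membership of the root hold for every such poset, so being a tree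
  amounts to acyclicity. If \<open>\<bottom>\<close> is the only element, the root condition is
  vacuous.\<close>

lemma tree_rooted_at_top_iff:
  "tree_rooted_at (carrier P - {\<bottom>}) nonzero_edges \<top> \<longleftrightarrow> single_valued nonzero_covers"
proof -
  have "\<top> \<noteq> \<bottom>" if "x \<in> carrier P - {\<bottom>}" for x
    using that nonzero_above[of x \<top>] by auto
  then have "carrier P - {\<bottom>} \<noteq> {} \<longrightarrow> \<top> \<in> carrier P - {\<bottom>}"
    by blast
  then show ?thesis
    unfolding tree_rooted_at_def tree_graph_def
    using nonzero_graph_connected acyclic_imp_single_valued single_valued_imp_acyclic by blast
qed

text \<open>Only one path of covers leads upward from a nonzero \<open>x\<close>, and both
  \<open>y\<close> and \<open>z\<close> lie on it.\<close>

lemma single_valued_imp_comparable: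
  assumes sv: "single_valued nonzero_covers"
    and carr: "x \<in> carrier P" "y \<in> carrier P" "z \<in> carrier P"
    and "x \<noteq> \<bottom>" "x \<sqsubseteq> y" "x \<sqsubseteq> z"
  shows "y \<sqsubseteq> z \<or> z \<sqsubseteq> y"
proof -
  have up: "(x, w) \<in> nonzero_covers\<^sup>*" if "w \<in> carrier P" "x \<sqsubseteq> w" for w
    using le_imp_covers_rtrancl[OF carr(1) that]
  proof (induction rule: rtrancl_induct)
    case (step u v)
    then have "u \<in> carrier P \<and> x \<sqsubseteq> u"
      using covers_rtrancl_imp_le carr(1) by blast
    then have "u \<noteq> \<bottom>"
      using nonzero_above carr(1) \<open>x \<noteq> \<bottom>\<close> by blast
    then show ?case
      using step by (auto intro: rtrancl_into_rtrancl)
  qed simp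
  have "(y, z) \<in> nonzero_covers\<^sup>* \<or> (z, y) \<in> nonzero_covers\<^sup>*"
    using single_valued_confluent[OF sv] up assms by blast
  moreover have "nonzero_covers\<^sup>* \<subseteq> {(x, y). covers P x y}\<^sup>*"
    by (rule rtrancl_mono) auto
  ultimately show ?thesis
    using covers_rtrancl_imp_le carr by blast
qed

section \<open>A pairwise description of the cover poset\<close>

text \<open>The relation is not transitive in general and is meant for \<open>sorted_wrt\<close>,
  which compares all pairs of positions. Three nonzero values \<open>p\<close>, \<open>q\<close>,
  \<open>r\<close> in increasing order are thereby excluded, as \<open>r\<close> does not cover
  \<open>p\<close>.\<close>

definition tree_step :: "'a \<Rightarrow> 'a \<Rightarrow> bool" where
  "tree_step x y \<longleftrightarrow> x \<sqsubseteq> y \<and> (x = \<bottom> \<or> x = y \<or> covers P x y)"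

text \<open>Membership in the cover poset becomes a condition on pairs of entries, against which
  componentwise operations can be checked. Forwards, a nonzero head is equal to or covered by every
  later entry.\<close>

lemma sorted_wrt_tree_step_iff:
  assumes "set xs \<subseteq> carrier P"
  shows "sorted_wrt tree_step xs \<longleftrightarrow> sorted_wrt (\<sqsubseteq>) xs \<and>
     (set xs - {\<bottom>} = {} \<or> (\<exists>p. set xs - {\<bottom>} = {p}) \<or>
      (\<exists>p q. covers P p q \<and> set xs - {\<bottom>} = {p, q}))"
    (is "_ \<longleftrightarrow> _ \<and> ?C xs")
proof (intro iffI conjI)
  assume "sorted_wrt tree_step xs"
  then show "sorted_wrt (\<sqsubseteq>) xs"
    by (rule sorted_wrt_mono_rel[rotated]) (simp add: tree_step_def)
next
  assume "sorted_wrt tree_step xs"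
  then show "?C xs"
    using assms
  proof (induction xs)
    case (Cons x xs)
    then have xs: "sorted_wrt tree_step xs" "set xs \<subseteq> carrier P"
      and st: "\<And>y. y \<in> set xs \<Longrightarrow> tree_step x y"
      by simp_all
    have C: "?C xs"
      by (rule Cons.IH[OF xs])
    show ?case
    proof (cases "x = \<bottom>")
      case True
      then show ?thesis using C by simp
    next
      case False
      then have *: "set (x # xs) - {\<bottom>} = insert x (set xs - {\<bottom>})"
        by auto
      have st': "y = x \<or> covers P x y" if "y \<in> set xs" for y
        using st[OF that] False by (auto simp: tree_step_def)
      from C consider "set xs - {\<bottom>} = {}" | p where "set xs - {\<bottom>} = {p}"
        | p q where "covers P p q" "set xs - {\<bottom>} = {p, q}"
        by blast
      then show ?thesis
      proof cases
        case 1
        then have "set (x # xs) - {\<bottom>} = {x}"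
          unfolding * by (rule arg_cong)
        then show ?thesis by blast
      next
        case (2 p)
        then consider "p = x" | "covers P x p"
          using st'[of p] by blast
        then show ?thesis
          unfolding * 2 by cases blast+
      next
        case (3 p q)
        then have pq: "p = x \<or> covers P x p" "q = x \<or> covers P x q"
          using st'[of p] st'[of q] by blast+
        \<comment> \<open>If \<open>p\<close> were not \<open>x\<close>, it would cover
          \<open>x\<close>; then \<open>q = x\<close> would put \<open>q\<close> below
          \<open>p\<close>, and \<open>q\<close> covering \<open>x\<close> would leave
          \<open>p\<close> strictly in between.\<close>
        have "\<not> q \<sqsubseteq> p"
          using coversD[OF 3(1)] le_antisym by metis
        then have "p = x"
          using pq 3(1) unfolding covers_iff by metis
        then show ?thesis
          unfolding * 3(2) using 3(1) by blast
      qed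
    qed
  qed simp
next
  assume *: "sorted_wrt (\<sqsubseteq>) xs \<and> ?C xs"
  show "sorted_wrt tree_step xs"
  proof (rule sorted_wrt_mono_rel[of xs "(\<sqsubseteq>)"])
    fix x y assume xy: "x \<in> set xs" "y \<in> set xs" "x \<sqsubseteq> y"
    then have carr: "x \<in> carrier P" "y \<in> carrier P"
      using assms by auto
    show "tree_step x y"
    proof (cases "x = \<bottom>")
      case False
      then have "y \<noteq> \<bottom>"
        using nonzero_above carr xy(3) by blast
      then have mem: "x \<in> set xs - {\<bottom>}" "y \<in> set xs - {\<bottom>}"
        using xy False by auto
      from conjunct2[OF *] consider "set xs - {\<bottom>} = {}" | p where "set xs - {\<bottom>} = {p}"
        | p q where "covers P p q" "set xs - {\<bottom>} = {p, q}"
        by blast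
      then have "x = y \<or> covers P x y"
      proof cases
        case (3 p q)
        have "x \<in> {p, q}" "y \<in> {p, q}"
          using mem unfolding 3(2) .
        then have "x = y \<or> covers P x y \<or> x = q \<and> y = p"
          using 3(1) by (elim insertE emptyE) simp_all
        moreover have "\<not> q \<sqsubseteq> p"
          using coversD[OF 3(1)] le_antisym by metis
        ultimately show ?thesis
          using xy(3) by blast
      qed (use mem in auto)
      then show ?thesis
        using xy(3) by (simp add: tree_step_def)
    qed (use xy in \<open>simp add: tree_step_def\<close>)
  qed (use * in blast)
qed

lemma carrier_cover_poset:
  "carrier (cover_poset P m) =
     {xs. length xs = m \<and> set xs \<subseteq> carrier P \<and> sorted_wrt tree_step xs}"
proof -
  have "xs \<in> carrier (cover_poset P m) \<longleftrightarrow>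
      length xs = m \<and> set xs \<subseteq> carrier P \<and> sorted_wrt tree_step xs" for xs
    unfolding cover_poset_def power_poset_def
    by (simp add: sorted_wrt_tree_step_iff cong: conj_cong)
  then show ?thesis
    by blast
qed

lemma le_cover_poset: "le (cover_poset P m) = list_all2 (\<sqsubseteq>)"
  by (simp add: cover_poset_def power_poset_def)

lemma eq_cover_poset: "eq (cover_poset P m) = (=)"
  by (simp add: cover_poset_def power_poset_def)

lemma partial_order_cover_poset: "partial_order (cover_poset P m)"
proof -
  have nth: "xs ! i \<in> carrier P" if "xs \<in> carrier (cover_poset P m)" "i < m" for xs i
    using that by (auto simp: carrier_cover_poset)
  have len: "length xs = m" if "xs \<in> carrier (cover_poset P m)" for xs
    using that by (simp add: carrier_cover_poset)
  show ?thesis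
  proof (unfold_locales, simp_all only: le_cover_poset eq_cover_poset)
    fix xs assume "xs \<in> carrier (cover_poset P m)"
    then show "list_all2 (\<sqsubseteq>) xs xs"
      using nth len by (auto simp: list_all2_conv_all_nth)
  next
    fix xs ys
    assume "list_all2 (\<sqsubseteq>) xs ys" "list_all2 (\<sqsubseteq>) ys xs"
      "xs \<in> carrier (cover_poset P m)" "ys \<in> carrier (cover_poset P m)"
    then show "xs = ys"
      using nth len by (intro nth_equalityI) (auto simp: list_all2_conv_all_nth intro!: le_antisym)
  next
    fix xs ys zs
    assume "list_all2 (\<sqsubseteq>) xs ys" "list_all2 (\<sqsubseteq>) ys zs" "xs \<in> carrier (cover_poset P m)"
      "ys \<in> carrier (cover_poset P m)" "zs \<in> carrier (cover_poset P m)"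
    then show "list_all2 (\<sqsubseteq>) xs zs"
      using nth len le_trans by (auto simp: list_all2_conv_all_nth)
  qed
qed

lemma finite_cover_poset: "finite (carrier (cover_poset P m))"
proof (rule finite_subset)
  show "carrier (cover_poset P m) \<subseteq> {xs. set xs \<subseteq> carrier P \<and> length xs = m}"
    by (auto simp: carrier_cover_poset)
qed (simp add: finite_carrier finite_lists_length_eq)

lemma top_cover_poset: "greatest (cover_poset P m) (replicate m \<top>) (carrier (cover_poset P m))"
proof -
  have "replicate m \<top> \<in> carrier (cover_poset P m)"
    by (simp add: carrier_cover_poset sorted_wrt_iff_nth_less tree_step_def set_replicate_conv_if)
  moreover have "list_all2 (\<sqsubseteq>) xs (replicate m \<top>)" if "xs \<in> carrier (cover_poset P m)" for xs
    using that unfolding carrier_cover_poset list_all2_conv_all_nth by (simp add: nth_mem subset_iff)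
  ultimately show ?thesis
    unfolding greatest_def le_cover_poset by (simp add: carrier_cover_poset)
qed

section \<open>Componentwise meets and sufficiency\<close>

text \<open>The meet of two elements, provided that \<open>P\<close> without \<open>\<bottom>\<close> is a tree.\<close>

definition tree_meet :: "'a \<Rightarrow> 'a \<Rightarrow> 'a" where
  "tree_meet x y = (if x \<sqsubseteq> y then x else if y \<sqsubseteq> x then y else \<bottom>)"

lemma tree_meet_closed: "x \<in> carrier P \<Longrightarrow> y \<in> carrier P \<Longrightarrow> tree_meet x y \<in> carrier P"
  by (auto simp: tree_meet_def)

lemma tree_meet_lower:
  assumes "x \<in> carrier P" "y \<in> carrier P"
  shows "tree_meet x y \<sqsubseteq> x" "tree_meet x y \<sqsubseteq> y"
  using assms by (auto simp: tree_meet_def)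

lemma tree_meet_commute:
  assumes "x \<in> carrier P" "y \<in> carrier P"
  shows "tree_meet x y = tree_meet y x"
  using assms le_antisym by (auto simp: tree_meet_def)

text \<open>A nonzero common lower bound forces \<open>x\<close> and \<open>y\<close> to be
  comparable; hence incomparable elements have only \<open>\<bottom>\<close> below both.\<close>

lemma tree_meet_greatest:
  assumes "single_valued nonzero_covers"
    and "x \<in> carrier P" "y \<in> carrier P" "z \<in> carrier P" "z \<sqsubseteq> x" "z \<sqsubseteq> y"
  shows "z \<sqsubseteq> tree_meet x y"
  using single_valued_imp_comparable[OF assms(1), of z x y] assms
  by (cases "z = \<bottom>") (auto simp: tree_meet_def)

text \<open>The first meet is \<open>x\<close>. If \<open>x\<close> is nonzero, then
  \<open>x'\<close> and \<open>y'\<close> both lie above it and are comparable, so the second meet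
  is one of them. It lies between \<open>x\<close> and \<open>x'\<close>, and nothing lies strictly
  between these two.\<close>

lemma tree_step_tree_meet_of_le:
  assumes sv: "single_valued nonzero_covers"
    and carr: "x \<in> carrier P" "x' \<in> carrier P" "y \<in> carrier P" "y' \<in> carrier P"
    and st: "tree_step x x'" "tree_step y y'" and xy: "x \<sqsubseteq> y"
  shows "tree_step (tree_meet x y) (tree_meet x' y')"
proof -
  have le: "x \<sqsubseteq> x'" "x \<sqsubseteq> y'"
    using st xy le_trans[of x y y'] carr by (auto simp: tree_step_def)
  have "x = \<bottom> \<or> x = tree_meet x' y' \<or> covers P x (tree_meet x' y')"
  proof (cases "x = \<bottom>")
    case False
    then have x': "x' = x \<or> covers P x x'"
      using st by (auto simp: tree_step_def)
    consider "x' \<sqsubseteq> y'" | "\<not> x' \<sqsubseteq> y'" "y' \<sqsubseteq> x'"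
      using single_valued_imp_comparable[OF sv, of x x' y'] False le carr by blast
    then show ?thesis
    proof cases
      case 1
      then show ?thesis
        using x' by (auto simp: tree_meet_def)
    next
      case 2
      then have "x' = x \<longrightarrow> y' = x" "covers P x x' \<longrightarrow> y' = x \<or> y' = x'"
        using le carr le_antisym by (auto simp: covers_iff)
      then show ?thesis
        using 2 x' by (auto simp: tree_meet_def)
    qed
  qed simp
  moreover have "x \<sqsubseteq> tree_meet x' y'"
    using tree_meet_greatest[OF sv] carr le by blast
  moreover have "tree_meet x y = x"
    using xy by (simp add: tree_meet_def)
  ultimately show ?thesis
    by (simp add: tree_step_def)
qed

text \<open>By symmetry the comparable case reduces to the preceding lemma; otherwise the first meet
  is \<open>\<bottom>\<close>, which steps to everything.\<close>

lemma tree_step_tree_meet: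
  assumes sv: "single_valued nonzero_covers"
    and carr: "x \<in> carrier P" "x' \<in> carrier P" "y \<in> carrier P" "y' \<in> carrier P"
    and st: "tree_step x x'" "tree_step y y'"
  shows "tree_step (tree_meet x y) (tree_meet x' y')"
proof -
  consider "x \<sqsubseteq> y" | "y \<sqsubseteq> x" | "\<not> x \<sqsubseteq> y" "\<not> y \<sqsubseteq> x"
    by blast
  then show ?thesis
  proof cases
    case 1
    then show ?thesis
      using tree_step_tree_meet_of_le assms by blast
  next
    case 2
    then show ?thesis
      using tree_step_tree_meet_of_le[OF sv, of y y' x x'] assms tree_meet_commute by simp
  next
    case 3
    then have "tree_meet x y = \<bottom>"
      by (simp add: tree_meet_def)
    then show ?thesis
      using tree_meet_closed carr by (simp add: tree_step_def)
  qed
qed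

text \<open>Componentwise meets remain in the cover poset. By finiteness all nonempty subsets then
  have meets, and together with the greatest element this gives a complete lattice, so joins exist
  as well.\<close>

lemma single_valued_imp_lattice:
  assumes sv: "single_valued nonzero_covers"
  shows "lattice (cover_poset P m)"
proof -
  let ?Q = "cover_poset P m"
  have meet: "\<exists>i. greatest ?Q i (Lower ?Q {xs, ys})"
    if xs: "xs \<in> carrier ?Q" and ys: "ys \<in> carrier ?Q" for xs ys
  proof -
    have len: "length xs = m" "length ys = m"
      and nth: "\<And>i. i < m \<Longrightarrow> xs ! i \<in> carrier P" "\<And>i. i < m \<Longrightarrow> ys ! i \<in> carrier P"
      using xs ys by (auto simp: carrier_cover_poset)
    let ?z = "map2 tree_meet xs ys"
    have z: "?z \<in> carrier ?Q"
      using xs ys nth len tree_meet_closed sv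
      by (auto simp: carrier_cover_poset sorted_wrt_iff_nth_less set_conv_nth
          intro!: tree_step_tree_meet)
    have "greatest ?Q ?z (Lower ?Q {xs, ys})"
    proof (rule greatest_LowerI)
      fix w assume "w \<in> {xs, ys}"
      then show "le ?Q ?z w"
        using len nth tree_meet_lower by (auto simp: le_cover_poset list_all2_conv_all_nth)
    next
      fix w assume "w \<in> Lower ?Q {xs, ys}"
      then have "w \<in> carrier ?Q" "list_all2 (\<sqsubseteq>) w xs" "list_all2 (\<sqsubseteq>) w ys"
        using xs ys by (auto simp: Lower_def le_cover_poset)
      then show "le ?Q w ?z"
        using len nth
        by (auto simp: le_cover_poset list_all2_conv_all_nth carrier_cover_poset
            intro!: tree_meet_greatest[OF sv])
    qed (use xs ys z in auto)
    then show ?thesis ..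
  qed
  interpret Q: partial_order ?Q
    by (rule partial_order_cover_poset)
  interpret Q: lower_semilattice ?Q
    by unfold_locales (rule meet)
  interpret Q: complete_lattice ?Q
  proof (rule Q.complete_lattice_criterion1)
    show "\<exists>g. greatest ?Q g (carrier ?Q)"
      using top_cover_poset by blast
  next
    fix A assume "A \<subseteq> carrier ?Q" "A \<noteq> {}"
    then show "\<exists>i. greatest ?Q i (Lower ?Q A)"
      using Q.finite_inf_greatest[of A] finite_cover_poset finite_subset by blast
  qed
  show ?thesis ..
qed

section \<open>Necessity from pairs\<close>

lemma pair_in_cover_poset_iff:
  "[x, y] \<in> carrier (cover_poset P 2) \<longleftrightarrow> x \<in> carrier P \<and> y \<in> carrier P \<and> tree_step x y"
  by (auto simp: carrier_cover_poset)

text \<open>Let \<open>(p, q)\<close> be the join of \<open>(x, a)\<close> and \<open>(x, b)\<close>, and let \<open>a'\<close>, \<open>b'\<close> be lower covers of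
  \<open>q\<close> above \<open>a\<close>, \<open>b\<close>. Then \<open>(a', q)\<close> and \<open>(b', q)\<close> are also upper bounds, which forces
  \<open>p = a' = b'\<close>, so that already \<open>(p, p)\<close> is an upper bound.\<close>

lemma lattice_imp_single_valued:
  assumes "lattice (cover_poset P 2)"
  shows "single_valued nonzero_covers"
proof (rule single_valuedI)
  let ?Q = "cover_poset P 2"
  interpret Q: lattice ?Q by fact
  fix x a b assume "(x, a) \<in> nonzero_covers" "(x, b) \<in> nonzero_covers"
  then have xa: "covers P x a" and xb: "covers P x b" and x0: "x \<noteq> \<bottom>"
    by auto
  note aD = coversD[OF xa] and bD = coversD[OF xb]
  show "a = b"
  proof (rule ccontr)
    assume ab: "a \<noteq> b"
    have mem: "[x, a] \<in> carrier ?Q" "[x, b] \<in> carrier ?Q"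
      using xa xb aD bD by (auto simp: pair_in_cover_poset_iff tree_step_def)
    then obtain s where s: "least ?Q s (Upper ?Q {[x, a], [x, b]})"
      using Q.sup_of_two_exists by blast
    then have sU: "s \<in> Upper ?Q {[x, a], [x, b]}"
      by (rule least_mem)
    then have "length s = 2" and s_carr: "s \<in> carrier ?Q"
      by (auto simp: Upper_def carrier_cover_poset)
    then obtain p q where pq: "s = [p, q]"
      by (metis (no_types) Suc_length_conv length_0_conv numeral_2_eq_2)
    have carr: "p \<in> carrier P" "q \<in> carrier P" and st: "tree_step p q"
      using s_carr unfolding pq pair_in_cover_poset_iff by auto
    have le: "x \<sqsubseteq> p" "a \<sqsubseteq> q" "b \<sqsubseteq> q"
      using sU mem unfolding pq by (auto simp: Upper_def le_cover_poset)
    have least: "p \<sqsubseteq> u \<and> q \<sqsubseteq> v" if "u \<in> carrier P" "v \<in> carrier P" "tree_step u v"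
      "x \<sqsubseteq> u" "a \<sqsubseteq> v" "b \<sqsubseteq> v" for u v
    proof -
      have "[u, v] \<in> Upper ?Q {[x, a], [x, b]}"
        using that mem pair_in_cover_poset_iff by (auto simp: Upper_def le_cover_poset)
      then have "le ?Q s [u, v]"
        using s by (auto dest: least_le)
      then show ?thesis
        by (simp add: pq le_cover_poset)
    qed
    have p0: "p \<noteq> \<bottom>"
      using nonzero_above aD carr le x0 by blast
    \<comment> \<open>\<open>[c, q]\<close> is an upper bound, so \<open>p\<close> lies below
      \<open>c\<close> and strictly below \<open>q\<close>. As \<open>p\<close> is nonzero,
      \<open>q\<close> covers it, which leaves no room for \<open>c\<close> strictly
      between.\<close>
    have key: "p = c" if "c \<in> carrier P" "x \<sqsubseteq> c" "covers P c q" for c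
    proof -
      have "p \<sqsubseteq> c"
        using least[of c q] that carr le coversD[of c q] by (auto simp: tree_step_def)
      moreover have "p \<noteq> q"
        using \<open>p \<sqsubseteq> c\<close> that coversD[of c q] le_antisym[of c q] by auto
      then have "covers P p q"
        using st p0 by (simp add: tree_step_def)
      ultimately show "p = c"
        using that coversD[of c q] unfolding covers_iff by blast
    qed
    \<comment> \<open>If \<open>q\<close> were \<open>a\<close> or \<open>b\<close>, the two
      distinct covers of \<open>x\<close> would be comparable.\<close>
    have "a \<noteq> q" "b \<noteq> q"
      using le ab xa xb aD bD unfolding covers_iff by auto
    then obtain c d where cd: "a \<sqsubseteq> c" "covers P c q" "b \<sqsubseteq> d" "covers P d q"
      using lower_cover_above aD bD carr le by metis
    then have "p = c" "p = d"
      using key[of c] key[of d] coversD[of c q] coversD[of d q] le_trans[of x a c]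
        le_trans[of x b d] aD bD by auto
    then have "q \<sqsubseteq> p"
      using least[of p p] cd carr le by (simp add: tree_step_def)
    then show False
      using cd \<open>p = c\<close> coversD[of c q] le_antisym[of p q] by auto
  qed
qed

end

theorem theorem1p1:
  fixes P :: "('a, 'b) gorder_scheme"
  assumes "partial_order P"
    and "finite (carrier P)"
    and "weak_partial_order_bottom P"
    and "weak_partial_order_top P"
  shows "(\<forall>m::nat. m > 0 \<longrightarrow> lattice (cover_poset P m)) \<longleftrightarrow>
    tree_rooted_at (carrier P - {\<bottom>\<^bsub>P\<^esub>}) {e \<in> hasse_edges P. \<bottom>\<^bsub>P\<^esub> \<notin> e} \<top>\<^bsub>P\<^esub>"
proof -
  interpret finite_bounded_poset P
    by (intro finite_bounded_poset.intro finite_bounded_poset_axioms.intro assms)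
  show ?thesis
    unfolding tree_rooted_at_top_iff
  proof (intro iffI allI impI)
    assume "\<forall>m>0. lattice (cover_poset P m)"
    then have "lattice (cover_poset P 2)"
      by simp
    then show "single_valued nonzero_covers"
      by (rule lattice_imp_single_valued)
  qed (rule single_valued_imp_lattice)
qed

end
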